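(* There exist a compact two-step nilpotent topological group $G$ and a subgroup $P$ of $\mathrm{Aut}(G)$ such that the topological semidirect product $G\leftthreetimes P$ is not minimal.
   Context: All topological groups are Hausdorff. $\mathrm{Aut}(G)$ is the group of all topological automorphisms of $G$, equipped with the compact-open topology, which makes it a topological group. For a subgroup $P\leq \mathrm{Aut}(G)$ (with the subspace topology), $G\leftthreetimes P$ denotes the set $G\times P$ with the product topology and the multiplication $(x,f)(y,g)=(x\cdot f(y),\, f\circ g)$. A Hausdorff topological group is minimal if it does not admit a strictly coarser Hausdorff group topology. *)

theory Defs
  imports "HOL-Analysis.Analysis" "HOL-Algebra.Bij" "HOL-Algebra.Generated_Groups"
begin

definition Hausdorff_topological_group :: "('a, 'b) monoid_scheme \<Rightarrow> 'a topology \<Rightarrow> bool" where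
  "Hausdorff_topological_group G T \<longleftrightarrow>
     group G \<and> topspace T = carrier G \<and>
     continuous_map (prod_topology T T) T (\<lambda>(x, y). x \<otimes>\<^bsub>G\<^esub> y) \<and>
     continuous_map T T (\<lambda>x. inv\<^bsub>G\<^esub> x) \<and>
     Hausdorff_space T"

(* That (G, T) is itself a Hausdorff topological group is a standing assumption here and is
   deliberately not a conjunct: otherwise the negation could hold for the wrong reason. *)
definition minimal_topological_group :: "('a, 'b) monoid_scheme \<Rightarrow> 'a topology \<Rightarrow> bool" where
  "minimal_topological_group G T \<longleftrightarrow>
     \<not> (\<exists>T'. Hausdorff_topological_group G T' \<and>
            (\<forall>U. openin T' U \<longrightarrow> openin T U) \<and> T' \<noteq> T)"

primrec lower_central_series :: "('a, 'b) monoid_scheme \<Rightarrow> nat \<Rightarrow> 'a set" where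
  "lower_central_series G 0 = carrier G"
| "lower_central_series G (Suc n) =
     generate G {x \<otimes>\<^bsub>G\<^esub> y \<otimes>\<^bsub>G\<^esub> inv\<^bsub>G\<^esub> x \<otimes>\<^bsub>G\<^esub> inv\<^bsub>G\<^esub> y | x y.
                 x \<in> lower_central_series G n \<and> y \<in> carrier G}"

definition nilpotent_of_class :: "('a, 'b) monoid_scheme \<Rightarrow> nat \<Rightarrow> bool" where
  "nilpotent_of_class G n \<longleftrightarrow>
     lower_central_series G n = {\<one>\<^bsub>G\<^esub>} \<and>
     (\<forall>m<n. lower_central_series G m \<noteq> {\<one>\<^bsub>G\<^esub>})"

(* As in AutoGroup, automorphisms are extensional outside the carrier. *)
definition top_AutoGroup :: "('a, 'b) monoid_scheme \<Rightarrow> 'a topology \<Rightarrow> ('a \<Rightarrow> 'a) monoid" where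
  "top_AutoGroup G T =
     AutoGroup G \<lparr>carrier := {f \<in> auto G. homeomorphic_map T T f}\<rparr>"

definition compact_open_topology ::
    "('a, 'b) monoid_scheme \<Rightarrow> 'a topology \<Rightarrow> ('a \<Rightarrow> 'a) topology" where
  "compact_open_topology G T =
     topology_generated_by
       {{f \<in> carrier (top_AutoGroup G T). f ` K \<subseteq> U} | K U. compactin T K \<and> openin T U}"

definition semidirect_product ::
    "('a, 'b) monoid_scheme \<Rightarrow> ('a \<Rightarrow> 'a) set \<Rightarrow> ('a \<times> ('a \<Rightarrow> 'a)) monoid" where
  "semidirect_product G P =
     \<lparr>carrier = carrier G \<times> P,
      mult = (\<lambda>(x, f) (y, g). (x \<otimes>\<^bsub>G\<^esub> f y, compose (carrier G) f g)),
      one = (\<one>\<^bsub>G\<^esub>, \<lambda>x\<in>carrier G. x)\<rparr>"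

definition semidirect_topology ::
    "('a, 'b) monoid_scheme \<Rightarrow> 'a topology \<Rightarrow> ('a \<Rightarrow> 'a) set \<Rightarrow> ('a \<times> ('a \<Rightarrow> 'a)) topology" where
  "semidirect_topology G T P =
     prod_topology T (subtopology (compact_open_topology G T) P)"

end

theory Submission
  imports Defs
begin

text \<open>
  The non-minimality comes from realising \<open>G \<leftthreetimes> P\<close> as a subgroup of a larger topological group
  in which it is not a topological semidirect product. Let \<open>H\<close> be a Hausdorff topological group,
  \<open>N\<close> a normal subgroup and \<open>S\<close> a subgroup with \<open>N \<inter> S = 1\<close>, acting faithfully on \<open>N\<close> by
  conjugation. With \<open>P\<close> the group of automorphisms of \<open>N\<close> induced by \<open>S\<close>, the map
  \<open>(x, c\<^sub>s) \<mapsto> x s\<close> is an injective homomorphism from the semidirect product of \<open>N\<close> and \<open>P\<close> to \<open>H\<close>,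
  so the topology of \<open>H\<close> pulls back to a Hausdorff group topology. It is coarser than the given one
  as soon as \<open>c\<^sub>s \<mapsto> s\<close> is continuous, and it differs from the given one if products \<open>x s\<close> can be
  arbitrarily close to 1 while \<open>x\<close> stays away from 1. This is
  \<open>semidirect_product_not_minimal\<close>.

  For compact \<open>N\<close> the last condition forces some net in \<open>S\<close> to converge to an element of \<open>N\<close>
  other than 1.
  The concrete choice is the Heisenberg group \<open>H\<close> over the ring of infinite binary sequences: triples
  \<open>(r, y, z)\<close> with product \<open>(r + r', y + y', z + z' + r y')\<close>, which is compact. Take \<open>N\<close> to be
  the triples with \<open>r\<close> a constant sequence and \<open>S\<close> the triples \<open>(r, 0, 0)\<close> with \<open>r\<close> finitely supported.
  The group \<open>N\<close> is closed and normal because \<open>r\<close> is a continuous homomorphism to an abelian group, in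
  which the constant sequences form a closed subgroup; and \<open>N\<close> has class two.
  A finitely supported constant sequence vanishes, so \<open>N \<inter> S = 1\<close>; but the finitely supported
  sequences \<open>1, ..., 1, 0, 0, ...\<close> converge to the constant sequence 1, so \<open>(1, 0, 0) s\<close> comes
  arbitrarily close to the identity (\<open>heis_const_times_heis_fin_near_one\<close>). Finally
  \<open>s\<close> is read off from \<open>c\<^sub>s\<close> by evaluating at the unit vectors of the \<open>y\<close> part, and evaluation is
  continuous for the compact-open topology (\<open>continuous_map_recover_conjugator\<close>).
\<close>

section \<open>Topological automorphisms and semidirect products\<close>

lemma top_AutoGroup_simps:
  "carrier (top_AutoGroup G T) = {f \<in> auto G. homeomorphic_map T T f}"
  "\<one>\<^bsub>top_AutoGroup G T\<^esub> = (\<lambda>x\<in>carrier G. x)"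
  by (simp_all add: top_AutoGroup_def AutoGroup_def BijGroup_def)

lemma top_AutoGroup_mult:
  assumes "f \<in> carrier (top_AutoGroup G T)" "g \<in> carrier (top_AutoGroup G T)"
  shows "f \<otimes>\<^bsub>top_AutoGroup G T\<^esub> g = compose (carrier G) f g"
  using assms by (simp add: top_AutoGroup_def AutoGroup_def BijGroup_def auto_def)

lemma group_top_AutoGroup:
  assumes "group G" and T: "topspace T = carrier G"
  shows "group (top_AutoGroup G T)"
proof -
  interpret group G by fact
  interpret A: group "AutoGroup G" by (rule AutoGroup)
  have "subgroup {f \<in> auto G. homeomorphic_map T T f} (AutoGroup G)"
  proof (rule A.subgroupI)
    show "{f \<in> auto G. homeomorphic_map T T f} \<subseteq> carrier (AutoGroup G)"
      by (auto simp: AutoGroup_def)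
    have "homeomorphic_map T T (\<lambda>x\<in>carrier G. x)"
      by (rule homeomorphic_map_eq[of _ _ id]) (simp_all add: T)
    then show "{f \<in> auto G. homeomorphic_map T T f} \<noteq> {}"
      using id_in_auto by blast
  next
    fix f assume f: "f \<in> {f \<in> auto G. homeomorphic_map T T f}"
    then have fA: "f \<in> carrier (AutoGroup G)" and fh: "homeomorphic_map T T f"
      by (simp_all add: AutoGroup_def)
    define g where "g = inv\<^bsub>AutoGroup G\<^esub> f"
    have gA: "g \<in> carrier (AutoGroup G)" using fA g_def by simp
    have B: "f \<in> Bij (carrier G)" "g \<in> Bij (carrier G)"
      using fA gA by (auto simp: AutoGroup_def auto_def)
    have "f \<otimes>\<^bsub>AutoGroup G\<^esub> g = \<one>\<^bsub>AutoGroup G\<^esub>" using fA g_def by simp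
    then have "compose (carrier G) f g = (\<lambda>x\<in>carrier G. x)"
      using B by (simp add: AutoGroup_def BijGroup_def)
    then have fg: "f (g x) = x" if "x \<in> carrier G" for x
      using that by (metis compose_eq restrict_apply')
    obtain h where h: "homeomorphic_maps T T f h" using fh homeomorphic_map_maps by blast
    have "g x = h x" if "x \<in> topspace T" for x
    proof -
      have "g x \<in> carrier G" using Bij_imp_funcset[OF B(2)] that T by auto
      then have "h (f (g x)) = g x" using h T by (simp add: homeomorphic_maps_def)
      then show ?thesis using fg that T by simp
    qed
    moreover have "homeomorphic_map T T h" using h homeomorphic_maps_map by blast
    ultimately have "homeomorphic_map T T g" by (metis homeomorphic_map_eq)
    then show "inv\<^bsub>AutoGroup G\<^esub> f \<in> {f \<in> auto G. homeomorphic_map T T f}"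
      using gA by (simp add: g_def AutoGroup_def)
  next
    fix f g assume f: "f \<in> {f \<in> auto G. homeomorphic_map T T f}"
      and g: "g \<in> {f \<in> auto G. homeomorphic_map T T f}"
    then have A: "f \<in> carrier (AutoGroup G)" "g \<in> carrier (AutoGroup G)"
      by (simp_all add: AutoGroup_def)
    have "f \<otimes>\<^bsub>AutoGroup G\<^esub> g = compose (carrier G) f g"
      using A by (simp add: AutoGroup_def BijGroup_def auto_def)
    moreover have "homeomorphic_map T T (compose (carrier G) f g)"
      by (rule homeomorphic_map_eq[of _ _ "f \<circ> g"])
        (use f g homeomorphic_map_compose T in \<open>auto simp: compose_eq\<close>)
    moreover have "f \<otimes>\<^bsub>AutoGroup G\<^esub> g \<in> auto G"
      using A.m_closed[OF A] by (simp add: AutoGroup_def)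
    ultimately show "f \<otimes>\<^bsub>AutoGroup G\<^esub> g \<in> {f \<in> auto G. homeomorphic_map T T f}"
      by simp
  qed
  then show ?thesis
    unfolding top_AutoGroup_def by (rule A.subgroup_imp_group)
qed

lemma group_semidirect_product:
  assumes "group G" and T: "topspace T = carrier G" and P: "subgroup P (top_AutoGroup G T)"
  shows "group (semidirect_product G P)"
proof -
  interpret G: group G by fact
  interpret A: group "top_AutoGroup G T" by (rule group_top_AutoGroup[OF assms(1,2)])
  interpret P: subgroup P "top_AutoGroup G T" by fact
  have auto: "f \<in> auto G" if "f \<in> P" for f
    using P.subset that by (auto simp: top_AutoGroup_simps)
  have cl [simp]: "f x \<in> carrier G" if "f \<in> P" "x \<in> carrier G" for f x
    using auto[OF that(1)] that(2) by (auto simp: auto_def hom_def)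
  have hom: "f (x \<otimes>\<^bsub>G\<^esub> y) = f x \<otimes>\<^bsub>G\<^esub> f y" if "f \<in> P" "x \<in> carrier G" "y \<in> carrier G" for f x y
    using auto[OF that(1)] that(2,3) by (auto simp: auto_def hom_def)
  have ext: "f \<in> extensional (carrier G)" if "f \<in> P" for f
    using auto[OF that] by (auto simp: auto_def Bij_def)
  have mul: "f \<otimes>\<^bsub>top_AutoGroup G T\<^esub> g = compose (carrier G) f g" if "f \<in> P" "g \<in> P" for f g
    using top_AutoGroup_mult P.subset that by blast
  have comp: "compose (carrier G) f g \<in> P" if "f \<in> P" "g \<in> P" for f g
    using P.m_closed[OF that] mul[OF that] by simp
  have one: "(\<lambda>x\<in>carrier G. x) \<in> P" using P.one_closed by (simp add: top_AutoGroup_simps)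
  have inv: "compose (carrier G) (inv\<^bsub>top_AutoGroup G T\<^esub> f) f = (\<lambda>x\<in>carrier G. x)"
    if "f \<in> P" for f
    using A.l_inv[of f] mul[OF P.m_inv_closed[OF that] that] P.subset that
    by (auto simp: top_AutoGroup_simps)
  show ?thesis
  proof (rule groupI)
    fix u v assume "u \<in> carrier (semidirect_product G P)" "v \<in> carrier (semidirect_product G P)"
    then show "u \<otimes>\<^bsub>semidirect_product G P\<^esub> v \<in> carrier (semidirect_product G P)"
      by (auto simp: semidirect_product_def comp)
  next
    show "\<one>\<^bsub>semidirect_product G P\<^esub> \<in> carrier (semidirect_product G P)"
      by (simp add: semidirect_product_def one)
  next
    fix u v w assume "u \<in> carrier (semidirect_product G P)" "v \<in> carrier (semidirect_product G P)"
      "w \<in> carrier (semidirect_product G P)"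
    moreover have "compose (carrier G) (compose (carrier G) f g) h = compose (carrier G) f (compose (carrier G) g h)"
      if "f \<in> P" "g \<in> P" "h \<in> P" for f g h
      using that by (auto simp: compose_def fun_eq_iff)
    ultimately show "u \<otimes>\<^bsub>semidirect_product G P\<^esub> v \<otimes>\<^bsub>semidirect_product G P\<^esub> w =
        u \<otimes>\<^bsub>semidirect_product G P\<^esub> (v \<otimes>\<^bsub>semidirect_product G P\<^esub> w)"
      by (auto simp: semidirect_product_def hom compose_eq G.m_assoc)
  next
    fix u assume "u \<in> carrier (semidirect_product G P)"
    then show "\<one>\<^bsub>semidirect_product G P\<^esub> \<otimes>\<^bsub>semidirect_product G P\<^esub> u = u"
      by (auto simp: semidirect_product_def Id_compose ext Pi_iff)
  next
    fix u assume u: "u \<in> carrier (semidirect_product G P)"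
    then obtain x f where xf: "u = (x, f)" "x \<in> carrier G" "f \<in> P"
      by (auto simp: semidirect_product_def)
    let ?g = "inv\<^bsub>top_AutoGroup G T\<^esub> f"
    have g: "?g \<in> P" using xf by simp
    show "\<exists>v\<in>carrier (semidirect_product G P). v \<otimes>\<^bsub>semidirect_product G P\<^esub> u = \<one>\<^bsub>semidirect_product G P\<^esub>"
      by (rule bexI[of _ "(inv\<^bsub>G\<^esub> (?g x), ?g)"])
        (use xf g inv in \<open>auto simp: semidirect_product_def\<close>)
  qed
qed

section \<open>Pulled back topologies and conjugation\<close>

lemma Hausdorff_topological_group_pullback:
  assumes H: "Hausdorff_topological_group H TH" and M: "group M"
    and hom: "\<phi> \<in> hom M H" and inj: "inj_on \<phi> (carrier M)"
  shows "Hausdorff_topological_group M (pullback_topology (carrier M) \<phi> TH)"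
proof -
  interpret group_hom M H \<phi>
    using H M hom by (simp add: group_hom_def group_hom_axioms_def Hausdorff_topological_group_def)
  let ?T = "pullback_topology (carrier M) \<phi> TH"
  have TH: "topspace TH = carrier H" and
    cm: "continuous_map (prod_topology TH TH) TH (\<lambda>(x, y). x \<otimes>\<^bsub>H\<^esub> y)" and
    ci: "continuous_map TH TH (\<lambda>x. inv\<^bsub>H\<^esub> x)" and haus: "Hausdorff_space TH"
    using H by (auto simp: Hausdorff_topological_group_def)
  have ts: "topspace ?T = carrier M"
    by (auto simp: topspace_pullback_topology TH)
  have \<phi>: "continuous_map ?T TH \<phi>"
    using continuous_map_pullback[of TH TH id "carrier M" \<phi>] by simp
  have "continuous_map (prod_topology ?T ?T) ?T (\<lambda>(x, y). x \<otimes>\<^bsub>M\<^esub> y)"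
  proof (rule continuous_map_pullback')
    have "continuous_map (prod_topology ?T ?T) TH ((\<lambda>(x, y). x \<otimes>\<^bsub>H\<^esub> y) \<circ> (\<lambda>p. (\<phi> (fst p), \<phi> (snd p))))"
      by (intro continuous_map_compose[OF _ cm] continuous_map_pairedI
          continuous_map_compose[OF continuous_map_fst \<phi>, unfolded o_def]
          continuous_map_compose[OF continuous_map_snd \<phi>, unfolded o_def])
    then show "continuous_map (prod_topology ?T ?T) TH (\<phi> \<circ> (\<lambda>(x, y). x \<otimes>\<^bsub>M\<^esub> y))"
      by (rule continuous_map_eq) (auto simp: ts)
  qed (auto simp: ts)
  moreover have "continuous_map ?T ?T (\<lambda>x. inv\<^bsub>M\<^esub> x)"
  proof (rule continuous_map_pullback')
    have "continuous_map ?T TH ((\<lambda>x. inv\<^bsub>H\<^esub> x) \<circ> \<phi>)"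
      by (rule continuous_map_compose[OF \<phi> ci])
    then show "continuous_map ?T TH (\<phi> \<circ> (\<lambda>x. inv\<^bsub>M\<^esub> x))"
      by (rule continuous_map_eq) (auto simp: ts)
  qed (auto simp: ts)
  moreover have "Hausdorff_space ?T"
    by (rule Hausdorff_space_injective_preimage[OF haus \<phi>]) (use inj ts in simp)
  ultimately show ?thesis
    using M ts by (simp add: Hausdorff_topological_group_def)
qed

lemma Hausdorff_topological_group_subgroup:
  assumes H: "Hausdorff_topological_group H TH" and N: "subgroup N H"
  shows "Hausdorff_topological_group (H\<lparr>carrier := N\<rparr>) (subtopology TH N)"
proof -
  interpret group H using H by (simp add: Hausdorff_topological_group_def)
  have TH: "topspace TH = carrier H" and
    cm: "continuous_map (prod_topology TH TH) TH (\<lambda>(x, y). x \<otimes>\<^bsub>H\<^esub> y)" and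
    ci: "continuous_map TH TH (\<lambda>x. inv\<^bsub>H\<^esub> x)" and haus: "Hausdorff_space TH"
    using H by (auto simp: Hausdorff_topological_group_def)
  have ts: "topspace (subtopology TH N) = N"
    using subgroup.subset[OF N] TH by (auto simp: topspace_subtopology)
  interpret N: subgroup N H by fact
  have "continuous_map (subtopology TH N) (subtopology TH N) (\<lambda>x. inv\<^bsub>H\<^esub> x)"
    using ts by (intro continuous_map_into_subtopology continuous_map_from_subtopology[OF ci]) auto
  then have "continuous_map (subtopology TH N) (subtopology TH N) (\<lambda>x. inv\<^bsub>H\<lparr>carrier := N\<rparr>\<^esub> x)"
    by (rule continuous_map_eq) (use ts m_inv_consistent[OF N] in simp)
  moreover have "continuous_map (prod_topology (subtopology TH N) (subtopology TH N)) (subtopology TH N) (\<lambda>(x, y). x \<otimes>\<^bsub>H\<^esub> y)"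
  proof (rule continuous_map_into_subtopology)
    show "continuous_map (prod_topology (subtopology TH N) (subtopology TH N)) TH (\<lambda>(x, y). x \<otimes>\<^bsub>H\<^esub> y)"
      using continuous_map_from_subtopology[OF cm, of "N \<times> N"] by (simp add: subtopology_Times)
  qed (use ts in auto)
  ultimately show ?thesis
    using ts haus subgroup_imp_group[OF N]
    by (simp add: Hausdorff_topological_group_def Hausdorff_space_subtopology)
qed

definition conjugation :: "('a, 'b) monoid_scheme \<Rightarrow> 'a set \<Rightarrow> 'a \<Rightarrow> 'a \<Rightarrow> 'a" where
  "conjugation H N s = (\<lambda>x\<in>N. s \<otimes>\<^bsub>H\<^esub> x \<otimes>\<^bsub>H\<^esub> inv\<^bsub>H\<^esub> s)"

lemma conjugation_hom:
  assumes H: "Hausdorff_topological_group H TH" and N: "N \<lhd> H"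
  shows "conjugation H N \<in> hom H (top_AutoGroup (H\<lparr>carrier := N\<rparr>) (subtopology TH N))"
proof -
  interpret N: normal N H by fact
  have TH: "topspace TH = carrier H" and
    cm: "continuous_map (prod_topology TH TH) TH (\<lambda>(x, y). x \<otimes>\<^bsub>H\<^esub> y)"
    using H by (auto simp: Hausdorff_topological_group_def)
  let ?G = "H\<lparr>carrier := N\<rparr>" and ?T = "subtopology TH N"
  have ts: "topspace ?T = N"
    using N.subset TH by (auto simp: topspace_subtopology)
  have cl: "conjugation H N s x \<in> N" if "s \<in> carrier H" "x \<in> N" for s x
    using N.inv_op_closed2[OF that] that by (simp add: conjugation_def)
  have comp: "conjugation H N s (conjugation H N t x) = conjugation H N (s \<otimes>\<^bsub>H\<^esub> t) x"
    if "s \<in> carrier H" "t \<in> carrier H" "x \<in> N" for s t x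
    using that N.inv_op_closed2[of t x] by (simp add: conjugation_def N.m_assoc N.inv_mult_group)
  have one: "conjugation H N \<one>\<^bsub>H\<^esub> x = x" if "x \<in> N" for x
    using that by (simp add: conjugation_def)
  have cont: "continuous_map ?T ?T (conjugation H N s)" if s: "s \<in> carrier H" for s
  proof -
    have *: "continuous_map TH TH (\<lambda>x. a \<otimes>\<^bsub>H\<^esub> x)" "continuous_map TH TH (\<lambda>x. x \<otimes>\<^bsub>H\<^esub> a)"
      if "a \<in> carrier H" for a
    proof -
      have "continuous_map TH (prod_topology TH TH) (\<lambda>x. (a, x))"
        "continuous_map TH (prod_topology TH TH) (\<lambda>x. (x, a))"
        using that TH by (auto intro!: continuous_map_pairedI)
      from this[THEN continuous_map_compose, OF cm]
      show "continuous_map TH TH (\<lambda>x. a \<otimes>\<^bsub>H\<^esub> x)" "continuous_map TH TH (\<lambda>x. x \<otimes>\<^bsub>H\<^esub> a)"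
        by (simp_all add: o_def)
    qed
    have "continuous_map TH TH (\<lambda>x. s \<otimes>\<^bsub>H\<^esub> x \<otimes>\<^bsub>H\<^esub> inv\<^bsub>H\<^esub> s)"
      using continuous_map_compose[OF *(1)[OF s] *(2)[OF N.inv_closed[OF s]]] by (simp add: o_def)
    then have "continuous_map ?T TH (conjugation H N s)"
      by (intro continuous_map_eq[OF continuous_map_from_subtopology])
        (auto simp: conjugation_def ts)
    then show ?thesis
      using cl[OF s] ts by (auto intro!: continuous_map_into_subtopology)
  qed
  have inv: "conjugation H N (inv\<^bsub>H\<^esub> s) (conjugation H N s x) = x"
    "conjugation H N s (conjugation H N (inv\<^bsub>H\<^esub> s) x) = x" if "s \<in> carrier H" "x \<in> N" for s x
    using that by (simp_all add: comp one)
  have mem: "conjugation H N s \<in> carrier (top_AutoGroup ?G ?T)" if s: "s \<in> carrier H" for s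
  proof -
    have "homeomorphic_maps ?T ?T (conjugation H N s) (conjugation H N (inv\<^bsub>H\<^esub> s))"
      using s cont inv ts by (simp add: homeomorphic_maps_def)
    then have "homeomorphic_map ?T ?T (conjugation H N s)"
      using homeomorphic_map_maps by blast
    moreover have "conjugation H N s \<in> hom ?G ?G"
    proof (rule homI)
      fix x y assume "x \<in> carrier ?G" "y \<in> carrier ?G"
      then have xy: "x \<in> N" "y \<in> N" by auto
      have "inv\<^bsub>H\<^esub> s \<otimes>\<^bsub>H\<^esub> (s \<otimes>\<^bsub>H\<^esub> (y \<otimes>\<^bsub>H\<^esub> inv\<^bsub>H\<^esub> s)) = y \<otimes>\<^bsub>H\<^esub> inv\<^bsub>H\<^esub> s"
        using s xy by (simp flip: N.m_assoc)
      then show "conjugation H N s (x \<otimes>\<^bsub>?G\<^esub> y) = conjugation H N s x \<otimes>\<^bsub>?G\<^esub> conjugation H N s y"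
        using s xy by (simp add: conjugation_def N.m_assoc)
    qed (use cl s in simp)
    moreover have "bij_betw (conjugation H N s) N N"
      by (rule bij_betw_byWitness[of _ "conjugation H N (inv\<^bsub>H\<^esub> s)"]) (use cl s inv in auto)
    ultimately show ?thesis
      by (simp add: top_AutoGroup_simps auto_def Bij_def conjugation_def)
  qed
  show ?thesis
  proof (rule homI)
    fix s t assume st: "s \<in> carrier H" "t \<in> carrier H"
    have "conjugation H N (s \<otimes>\<^bsub>H\<^esub> t) = compose N (conjugation H N s) (conjugation H N t)"
    proof
      fix x
      show "conjugation H N (s \<otimes>\<^bsub>H\<^esub> t) x = compose N (conjugation H N s) (conjugation H N t) x"
        by (cases "x \<in> N") (simp_all add: comp[OF st] compose_def, simp add: conjugation_def)
    qed
    then show "conjugation H N (s \<otimes>\<^bsub>H\<^esub> t) =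
        conjugation H N s \<otimes>\<^bsub>top_AutoGroup ?G ?T\<^esub> conjugation H N t"
      using top_AutoGroup_mult[OF mem[OF st(1)] mem[OF st(2)]] by simp
  qed (rule mem)
qed

lemma topspace_compact_open_topology:
  "topspace (compact_open_topology G T) = carrier (top_AutoGroup G T)"
proof -
  have "carrier (top_AutoGroup G T) \<in>
      {{f \<in> carrier (top_AutoGroup G T). f ` K \<subseteq> U} | K U. compactin T K \<and> openin T U}"
    by (rule CollectI, rule exI[of _ "{}"], rule exI[of _ "{}"]) simp
  then show ?thesis
    unfolding compact_open_topology_def topology_generated_by_topspace by blast
qed

text \<open>
  A point is a compact set, so the sets of automorphisms mapping a fixed point into a fixed open set
  belong to the subbase of the compact-open topology.
\<close>

lemma continuous_map_eval_compact_open: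
  assumes T: "topspace T = carrier G" and x: "x \<in> carrier G"
  shows "continuous_map (compact_open_topology G T) T (\<lambda>f. f x)"
proof -
  have cpt: "compactin T {x}" using x T by simp
  show ?thesis
  proof (rule continuous_map_openin_preimage_eq[THEN iffD2], intro conjI allI impI)
    show "(\<lambda>f. f x) \<in> topspace (compact_open_topology G T) \<rightarrow> topspace T"
      using x T by (fastforce simp: topspace_compact_open_topology top_AutoGroup_simps auto_def hom_def)
    fix U assume U: "openin T U"
    have "openin (compact_open_topology G T) {f \<in> carrier (top_AutoGroup G T). f ` {x} \<subseteq> U}"
      unfolding compact_open_topology_def
      by (rule topology_generated_by_Basis) (use U cpt in blast)
    moreover have "topspace (compact_open_topology G T) \<inter> (\<lambda>f. f x) -` U = {f \<in> carrier (top_AutoGroup G T). f ` {x} \<subseteq> U}"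
      by (auto simp: topspace_compact_open_topology)
    ultimately show "openin (compact_open_topology G T) (topspace (compact_open_topology G T) \<inter> (\<lambda>f. f x) -` U)"
      by simp
  qed
qed

text \<open>
  The function \<open>\<sigma>\<close> inverts \<open>s \<mapsto> c\<^sub>s\<close>; its existence encodes faithfulness of the action of \<open>S\<close> on \<open>N\<close>.
  If the two topologies coincided, then \<open>U \<times> P\<close>, an open neighbourhood of the identity, would
  contain all pairs \<open>(x, c\<^sub>s)\<close> with \<open>x s\<close> close enough to 1, contrary to the assumption on \<open>U\<close>.
\<close>

proposition semidirect_product_not_minimal:
  assumes H: "Hausdorff_topological_group H TH"
    and N: "N \<lhd> H" and S: "subgroup S H" and NS: "N \<inter> S = {\<one>\<^bsub>H\<^esub>}"
    and \<sigma>: "\<And>s. s \<in> S \<Longrightarrow> \<sigma> (conjugation H N s) = s"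
    and cont: "continuous_map
        (subtopology (compact_open_topology (H\<lparr>carrier := N\<rparr>) (subtopology TH N)) (conjugation H N ` S)) TH \<sigma>"
    and U: "openin (subtopology TH N) U" "\<one>\<^bsub>H\<^esub> \<in> U"
    and acc: "\<And>V. openin TH V \<Longrightarrow> \<one>\<^bsub>H\<^esub> \<in> V \<Longrightarrow> \<exists>x\<in>N - U. \<exists>s\<in>S. x \<otimes>\<^bsub>H\<^esub> s \<in> V"
  shows "subgroup (conjugation H N ` S) (top_AutoGroup (H\<lparr>carrier := N\<rparr>) (subtopology TH N))"
    and "\<not> minimal_topological_group
           (semidirect_product (H\<lparr>carrier := N\<rparr>) (conjugation H N ` S))
           (semidirect_topology (H\<lparr>carrier := N\<rparr>) (subtopology TH N) (conjugation H N ` S))"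
proof -
  interpret N: normal N H by fact
  interpret S: subgroup S H by fact
  let ?G = "H\<lparr>carrier := N\<rparr>" and ?T = "subtopology TH N" and ?P = "conjugation H N ` S"
  let ?A = "top_AutoGroup ?G ?T" and ?M = "semidirect_product ?G ?P"
  let ?TM = "semidirect_topology ?G ?T ?P"
  have TH: "topspace TH = carrier H" and
    cm: "continuous_map (prod_topology TH TH) TH (\<lambda>(x, y). x \<otimes>\<^bsub>H\<^esub> y)"
    using H by (auto simp: Hausdorff_topological_group_def)
  have G: "Hausdorff_topological_group ?G ?T"
    by (rule Hausdorff_topological_group_subgroup[OF H N.subgroup_axioms])
  have grG: "group ?G" and ts: "topspace ?T = carrier ?G"
    using G by (simp_all add: Hausdorff_topological_group_def)
  interpret A: group ?A by (rule group_top_AutoGroup[OF grG ts])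
  interpret c: group_hom H ?A "conjugation H N"
    using conjugation_hom[OF H N] by (unfold_locales)
  show P: "subgroup ?P ?A"
    by (rule c.subgroup_img_is_subgroup[OF S])
  have grM: "group ?M"
    by (rule group_semidirect_product[OF grG ts P])
  have cM: "carrier ?M = N \<times> ?P" by (simp add: semidirect_product_def)
  define \<phi> where "\<phi> = (\<lambda>(x, f). x \<otimes>\<^bsub>H\<^esub> \<sigma> f)"
  have \<phi>_eq: "\<phi> (x, conjugation H N s) = x \<otimes>\<^bsub>H\<^esub> s" if "s \<in> S" for x s
    using \<sigma>[OF that] by (simp add: \<phi>_def)
  have hom: "\<phi> \<in> hom ?M H"
  proof (rule homI)
    fix u assume "u \<in> carrier ?M"
    then show "\<phi> u \<in> carrier H" by (auto simp: cM \<phi>_eq)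
  next
    fix u v assume "u \<in> carrier ?M" "v \<in> carrier ?M"
    then obtain x s y t where uv: "u = (x, conjugation H N s)" "v = (y, conjugation H N t)"
      and xs: "x \<in> N" "s \<in> S" "y \<in> N" "t \<in> S"
      by (auto simp: cM)
    have st: "compose N (conjugation H N s) (conjugation H N t) = conjugation H N (s \<otimes>\<^bsub>H\<^esub> t)"
      using xs c.hom_mult[of s t] top_AutoGroup_mult[of "conjugation H N s" ?G ?T "conjugation H N t"]
      by simp
    have "\<phi> (u \<otimes>\<^bsub>?M\<^esub> v) = x \<otimes>\<^bsub>H\<^esub> (s \<otimes>\<^bsub>H\<^esub> y \<otimes>\<^bsub>H\<^esub> inv\<^bsub>H\<^esub> s) \<otimes>\<^bsub>H\<^esub> (s \<otimes>\<^bsub>H\<^esub> t)"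
      using xs by (simp add: uv semidirect_product_def st \<phi>_eq del: c.hom_mult) (simp add: conjugation_def)
    also have "\<dots> = (x \<otimes>\<^bsub>H\<^esub> s) \<otimes>\<^bsub>H\<^esub> (y \<otimes>\<^bsub>H\<^esub> t)"
    proof -
      have "inv\<^bsub>H\<^esub> s \<otimes>\<^bsub>H\<^esub> (s \<otimes>\<^bsub>H\<^esub> t) = t" using xs by (simp flip: N.m_assoc)
      then show ?thesis using xs by (simp add: N.m_assoc)
    qed
    finally show "\<phi> (u \<otimes>\<^bsub>?M\<^esub> v) = \<phi> u \<otimes>\<^bsub>H\<^esub> \<phi> v"
      using xs by (simp add: uv \<phi>_eq)
  qed
  have inj: "inj_on \<phi> (carrier ?M)"
  proof (rule inj_onI)
    fix u v assume "u \<in> carrier ?M" "v \<in> carrier ?M" and eq: "\<phi> u = \<phi> v"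
    then obtain x s y t where uv: "u = (x, conjugation H N s)" "v = (y, conjugation H N t)"
      and xs: "x \<in> N" "s \<in> S" "y \<in> N" "t \<in> S"
      by (auto simp: cM)
    have e: "x \<otimes>\<^bsub>H\<^esub> s = y \<otimes>\<^bsub>H\<^esub> t" using eq xs by (simp add: uv \<phi>_eq)
    have c: "x \<in> carrier H" "s \<in> carrier H" "y \<in> carrier H" "t \<in> carrier H"
      using xs by auto
    then have "y \<otimes>\<^bsub>H\<^esub> (t \<otimes>\<^bsub>H\<^esub> inv\<^bsub>H\<^esub> s) = x"
      using c N.inv_solve_right[of x "y \<otimes>\<^bsub>H\<^esub> t" s] e by (simp add: N.m_assoc)
    then have yx: "inv\<^bsub>H\<^esub> y \<otimes>\<^bsub>H\<^esub> x = t \<otimes>\<^bsub>H\<^esub> inv\<^bsub>H\<^esub> s"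
      using c N.inv_solve_left'[of "t \<otimes>\<^bsub>H\<^esub> inv\<^bsub>H\<^esub> s" y x] by simp
    have "inv\<^bsub>H\<^esub> y \<otimes>\<^bsub>H\<^esub> x \<in> N" "t \<otimes>\<^bsub>H\<^esub> inv\<^bsub>H\<^esub> s \<in> S" using xs by auto
    then have "inv\<^bsub>H\<^esub> y \<otimes>\<^bsub>H\<^esub> x = \<one>\<^bsub>H\<^esub>" using yx NS by auto
    then have "x = y" using c N.inv_solve_left'[of "\<one>\<^bsub>H\<^esub>" y x] by simp
    moreover from this have "s = t" using e c N.Units_l_cancel[of y s t] by (simp add: N.Units_eq)
    ultimately show "u = v" by (simp add: uv)
  qed
  define T' where "T' = pullback_topology (carrier ?M) \<phi> TH"
  have T': "Hausdorff_topological_group ?M T'"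
    unfolding T'_def by (rule Hausdorff_topological_group_pullback[OF H grM hom inj])
  have tsM: "topspace ?TM = carrier ?M"
    using ts subgroup.subset[OF P]
    by (auto simp: semidirect_topology_def cM topspace_compact_open_topology)
  have fst: "continuous_map ?TM ?T fst"
    unfolding semidirect_topology_def by (rule continuous_map_fst)
  have cont\<phi>: "continuous_map ?TM TH \<phi>"
  proof -
    have "continuous_map ?TM (prod_topology TH TH) (\<lambda>p. (fst p, \<sigma> (snd p)))"
    proof (rule continuous_map_pairedI)
      show "continuous_map ?TM TH (\<lambda>p. fst p)"
        using fst by (rule continuous_map_into_fulltopology)
      show "continuous_map ?TM TH (\<lambda>p. \<sigma> (snd p))"
        using continuous_map_compose[OF continuous_map_snd cont]
        unfolding semidirect_topology_def o_def .
    qed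
    from continuous_map_compose[OF this cm] show ?thesis
      by (simp add: o_def \<phi>_def case_prod_unfold)
  qed
  have coarser: "openin ?TM V" if V: "openin T' V" for V
  proof -
    obtain W where W: "openin TH W" "V = \<phi> -` W \<inter> carrier ?M"
      using V by (auto simp: T'_def openin_pullback_topology)
    show ?thesis
      using openin_continuous_map_preimage[OF cont\<phi> W(1)] W(2) tsM
      by (simp add: vimage_def Int_def conj_commute)
  qed
  have "T' \<noteq> ?TM"
  proof
    assume eq: "T' = ?TM"
    have "openin ?TM {p \<in> topspace ?TM. fst p \<in> U}"
      by (rule openin_continuous_map_preimage[OF fst U(1)])
    then obtain V where V: "openin TH V" "{p \<in> topspace ?TM. fst p \<in> U} = \<phi> -` V \<inter> carrier ?M"
      unfolding eq[symmetric] by (auto simp: T'_def openin_pullback_topology)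
    have "(\<one>\<^bsub>H\<^esub>, conjugation H N \<one>\<^bsub>H\<^esub>) \<in> {p \<in> topspace ?TM. fst p \<in> U}"
      using U(2) by (simp add: tsM cM del: c.hom_one)
    then have "(\<one>\<^bsub>H\<^esub>, conjugation H N \<one>\<^bsub>H\<^esub>) \<in> \<phi> -` V" using V(2) by blast
    then have "\<one>\<^bsub>H\<^esub> \<in> V" by (simp add: \<phi>_eq del: c.hom_one)
    then obtain x s where xs: "x \<in> N" "x \<notin> U" "s \<in> S" "x \<otimes>\<^bsub>H\<^esub> s \<in> V"
      using acc[OF V(1)] by blast
    then have "(x, conjugation H N s) \<in> \<phi> -` V \<inter> carrier ?M" by (simp add: \<phi>_eq cM)
    then have "(x, conjugation H N s) \<in> {p \<in> topspace ?TM. fst p \<in> U}" by (simp only: V(2))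
    then show False using xs(2) by simp
  qed
  then show "\<not> minimal_topological_group ?M ?TM"
    using T' coarser unfolding minimal_topological_group_def by blast
qed


section \<open>A Heisenberg group over infinite binary sequences\<close>

lemma nilpotent_of_class_2I:
  assumes "group G" and Z: "subgroup Z G"
    and comm: "\<And>x y. x \<in> carrier G \<Longrightarrow> y \<in> carrier G \<Longrightarrow>
      x \<otimes>\<^bsub>G\<^esub> y \<otimes>\<^bsub>G\<^esub> inv\<^bsub>G\<^esub> x \<otimes>\<^bsub>G\<^esub> inv\<^bsub>G\<^esub> y \<in> Z"
    and cent: "\<And>z y. z \<in> Z \<Longrightarrow> y \<in> carrier G \<Longrightarrow> z \<otimes>\<^bsub>G\<^esub> y = y \<otimes>\<^bsub>G\<^esub> z"
    and ab: "a \<in> carrier G" "b \<in> carrier G" "a \<otimes>\<^bsub>G\<^esub> b \<noteq> b \<otimes>\<^bsub>G\<^esub> a"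
  shows "nilpotent_of_class G 2"
proof -
  interpret group G by fact
  interpret Z: subgroup Z G by fact
  let ?c = "\<lambda>x y. x \<otimes>\<^bsub>G\<^esub> y \<otimes>\<^bsub>G\<^esub> inv\<^bsub>G\<^esub> x \<otimes>\<^bsub>G\<^esub> inv\<^bsub>G\<^esub> y"
  have c1: "?c x y = \<one>\<^bsub>G\<^esub> \<longleftrightarrow> x \<otimes>\<^bsub>G\<^esub> y = y \<otimes>\<^bsub>G\<^esub> x"
    if "x \<in> carrier G" "y \<in> carrier G" for x y
    using that by (simp add: inv_solve_right')
  have L1: "lower_central_series G (Suc 0) \<subseteq> Z"
    using comm by (auto intro!: generate_subgroup_incl[OF _ Z])
  have "?c a b \<in> lower_central_series G (Suc 0)"
    using ab by (auto intro!: generate.incl)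
  then have "lower_central_series G (Suc 0) \<noteq> {\<one>\<^bsub>G\<^esub>}"
    using c1[OF ab(1,2)] ab(3) by auto
  moreover have "lower_central_series G 0 \<noteq> {\<one>\<^bsub>G\<^esub>}"
    using ab by auto
  moreover have "lower_central_series G (Suc (Suc 0)) \<subseteq> {\<one>\<^bsub>G\<^esub>}"
    unfolding lower_central_series.simps(2)[of G "Suc 0"]
  proof (rule generate_subgroup_incl[OF _ triv_subgroup])
    show "{?c x y | x y. x \<in> lower_central_series G (Suc 0) \<and> y \<in> carrier G} \<subseteq> {\<one>\<^bsub>G\<^esub>}"
    proof clarify
      fix x y assume "x \<in> lower_central_series G (Suc 0)" "y \<in> carrier G"
      then show "?c x y = \<one>\<^bsub>G\<^esub>" using L1 cent c1 Z.subset by blast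
    qed
  qed
  moreover have "\<one>\<^bsub>G\<^esub> \<in> lower_central_series G (Suc (Suc 0))"
    unfolding lower_central_series.simps(2)[of G "Suc 0"] by (rule generate.one)
  ultimately show ?thesis
    by (auto simp: nilpotent_of_class_def numeral_2_eq_2 less_Suc_eq simp del: lower_central_series.simps)
qed

text \<open>
  The triple \<open>(r, y, z)\<close> of binary sequences is stored as a single sequence \<open>f\<close> with
  \<open>r k = f (3 * k)\<close>, \<open>y k = f (3 * k + 1)\<close> and \<open>z k = f (3 * k + 2)\<close>. Only the \<open>z\<close> coordinates
  of a product have the extra term \<open>r y'\<close>, found two places and one place before.
\<close>

definition heis :: "(nat \<Rightarrow> nat) monoid" where
  "heis = \<lparr>carrier = {f. \<forall>n. f n < 2},
     mult = (\<lambda>f g n. (f n + g n + (if n mod 3 = 2 then f (n - 2) * g (n - 1) else 0)) mod 2),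
     one = (\<lambda>n. 0)\<rparr>"

definition heis_top :: "(nat \<Rightarrow> nat) topology" where
  "heis_top = product_topology (\<lambda>n. discrete_topology {..<2}) UNIV"

definition heis_const :: "(nat \<Rightarrow> nat) set" where
  "heis_const = {f \<in> carrier heis. \<forall>n. n mod 3 = 0 \<longrightarrow> f n = f 0}"

definition heis_fin :: "(nat \<Rightarrow> nat) set" where
  "heis_fin = {f \<in> carrier heis. (\<forall>n. n mod 3 \<noteq> 0 \<longrightarrow> f n = 0) \<and> finite {n. f n \<noteq> 0}}"

text \<open>
  The centre of the group, consisting of the triples \<open>(0, 0, z)\<close>.
\<close>

definition heis_centre :: "(nat \<Rightarrow> nat) set" where
  "heis_centre = {f \<in> carrier heis. \<forall>n. n mod 3 \<noteq> 2 \<longrightarrow> f n = 0}"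

lemma carrier_heis: "f \<in> carrier heis \<longleftrightarrow> (\<forall>n. f n < 2)"
  by (simp add: heis_def)

lemma heis_constI:
  "f \<in> carrier heis \<Longrightarrow> (\<And>n. n mod 3 = 0 \<Longrightarrow> f n = f 0) \<Longrightarrow> f \<in> heis_const"
  unfolding heis_const_def by blast

lemma heis_constD:
  assumes "f \<in> heis_const"
  shows "f \<in> carrier heis" "n mod 3 = 0 \<Longrightarrow> f n = f 0"
proof -
  show "f \<in> carrier heis"
    using assms unfolding heis_const_def by blast
  show "f n = f 0" if "n mod 3 = 0"
  proof -
    have "\<forall>n. n mod 3 = 0 \<longrightarrow> f n = f 0"
      using assms unfolding heis_const_def by (elim CollectE conjE)
    from this[rule_format, OF that] show ?thesis .
  qed
qed

lemma heis_one: "\<one>\<^bsub>heis\<^esub> = (\<lambda>n. 0)"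
  by (simp add: heis_def)

lemma heis_mult:
  "(f \<otimes>\<^bsub>heis\<^esub> g) n = (f n + g n + (if n mod 3 = 2 then f (n - 2) * g (n - 1) else 0)) mod 2"
  by (simp add: heis_def)

lemma mod3_pred:
  assumes "n mod 3 = (2::nat)"
  shows "(n - 2) mod 3 = 0" "(n - 1) mod 3 = 1" "(n - Suc 0) mod 3 = 1"
proof -
  have "n = 3 * (n div 3) + 2" using assms div_mult_mod_eq[of n 3] by simp
  then obtain k where k: "n = 3 * k + 2" by blast
  show "(n - 2) mod 3 = 0" "(n - 1) mod 3 = 1" "(n - Suc 0) mod 3 = 1"
    using mod_mult_self2[of 1 3 k] by (simp_all add: k)
qed

lemma mod3_succ:
  assumes "n mod 3 = (0::nat)"
  shows "(n + 1) mod 3 = 1" "(n + 2) mod 3 = 2"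
proof -
  obtain k where k: "n = 3 * k" using assms by (auto elim: dvdE)
  show "(n + 1) mod 3 = 1" "(n + 2) mod 3 = 2"
    using mod_mult_self2[of 1 3 k] mod_mult_self2[of 2 3 k] by (simp_all add: k)
qed

lemma mod2_eq_iff:
  "(a::nat) mod 2 = b mod 2 \<longleftrightarrow> (even a \<longleftrightarrow> even b)" "(a::nat) mod 2 = 0 \<longleftrightarrow> even a"
  by presburger+

lemma heis_inv_eq:
  assumes "f \<in> carrier heis"
  shows "(\<lambda>n. (f n + (if n mod 3 = 2 then f (n - 2) * f (n - 1) else 0)) mod 2) \<otimes>\<^bsub>heis\<^esub> f = \<one>\<^bsub>heis\<^esub>"
proof
  fix n
  show "((\<lambda>n. (f n + (if n mod 3 = 2 then f (n - 2) * f (n - 1) else 0)) mod 2) \<otimes>\<^bsub>heis\<^esub> f) n = \<one>\<^bsub>heis\<^esub> n"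
  proof (cases "n mod 3 = 2")
    case True
    have x: "((a + b * c) mod 2 + a + (b mod 2) * c) mod 2 = 0" for a b c :: nat
      by (cases "even a"; cases "even (b * c)"; simp add: mod2_eq_iff)
    show ?thesis
      by (simp add: heis_mult heis_one True mod3_pred[OF True] x)
  qed (simp add: heis_mult heis_one mod2_eq_iff)
qed

lemma group_heis: "group heis"
proof (rule groupI)
  fix f g h assume "f \<in> carrier heis" "g \<in> carrier heis" "h \<in> carrier heis"
  show "f \<otimes>\<^bsub>heis\<^esub> g \<otimes>\<^bsub>heis\<^esub> h = f \<otimes>\<^bsub>heis\<^esub> (g \<otimes>\<^bsub>heis\<^esub> h)"
  proof
    fix n
    have l: "(a mod 2 + b + (c mod 2) * d) mod 2 = (a + b + c * d) mod 2"
      and r: "(a + b mod 2 + c * (d mod 2)) mod 2 = (a + b + c * d) mod 2" for a b c d :: nat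
      by (simp_all add: mod2_eq_iff)
    show "(f \<otimes>\<^bsub>heis\<^esub> g \<otimes>\<^bsub>heis\<^esub> h) n = (f \<otimes>\<^bsub>heis\<^esub> (g \<otimes>\<^bsub>heis\<^esub> h)) n"
    proof (cases "n mod 3 = 2")
      case True
      show ?thesis
        by (simp add: heis_mult True mod3_pred[OF True] l r) (simp add: algebra_simps)
    qed (simp add: heis_mult mod_simps add.assoc)
  qed
next
  fix f assume "f \<in> carrier heis"
  then show "\<exists>g\<in>carrier heis. g \<otimes>\<^bsub>heis\<^esub> f = \<one>\<^bsub>heis\<^esub>"
    by (rule bexI[where P = "\<lambda>g. g \<otimes>\<^bsub>heis\<^esub> f = \<one>\<^bsub>heis\<^esub>", OF heis_inv_eq]) (simp add: carrier_heis)
next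
  fix f assume "f \<in> carrier heis"
  then show "\<one>\<^bsub>heis\<^esub> \<otimes>\<^bsub>heis\<^esub> f = f"
    by (simp add: fun_eq_iff carrier_heis heis_mult heis_one)
qed (simp_all add: carrier_heis heis_mult heis_one)

interpretation heis: group heis by (rule group_heis)

lemma heis_inv:
  assumes "f \<in> carrier heis"
  shows "(inv\<^bsub>heis\<^esub> f) n = (f n + (if n mod 3 = 2 then f (n - 2) * f (n - 1) else 0)) mod 2"
  using heis.inv_equality[OF heis_inv_eq[OF assms] assms] by (simp add: carrier_heis)

lemma topspace_heis_top: "topspace heis_top = carrier heis"
  by (auto simp: heis_top_def carrier_heis PiE_def Pi_def)

lemma compact_heis_top: "compact_space heis_top"
  unfolding heis_top_def by (simp add: compact_space_product_topology compact_space_discrete_topology)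

lemma Hausdorff_heis_top: "Hausdorff_space heis_top"
  unfolding heis_top_def by (simp add: Hausdorff_space_product_topology Hausdorff_space_discrete_topology)

lemma continuous_map_discrete_binop:
  assumes "continuous_map X (discrete_topology A) f" "continuous_map X (discrete_topology B) g"
    and "\<And>a b. a \<in> A \<Longrightarrow> b \<in> B \<Longrightarrow> h a b \<in> C"
  shows "continuous_map X (discrete_topology C) (\<lambda>x. h (f x) (g x))"
proof -
  have "continuous_map X (discrete_topology (A \<times> B)) (\<lambda>x. (f x, g x))"
    using assms(1,2) by (simp add: prod_topology_discrete_topology continuous_map_pairedI)
  moreover have "continuous_map (discrete_topology (A \<times> B)) (discrete_topology C) (\<lambda>(a, b). h a b)"
    using assms(3) by auto
  ultimately have "continuous_map X (discrete_topology C) ((\<lambda>(a, b). h a b) \<circ> (\<lambda>x. (f x, g x)))"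
    by (rule continuous_map_compose)
  then show ?thesis by (simp add: o_def)
qed

lemma continuous_map_heis_coord:
  "continuous_map heis_top (discrete_topology {..<2}) (\<lambda>f. f n)"
  unfolding heis_top_def by (rule continuous_map_product_projection) simp

lemma Hausdorff_topological_group_heis: "Hausdorff_topological_group heis heis_top"
proof -
  let ?D = "discrete_topology {..<2::nat}"
  have p: "continuous_map (prod_topology heis_top heis_top) ?D (\<lambda>p. fst p n)"
    "continuous_map (prod_topology heis_top heis_top) ?D (\<lambda>p. snd p n)" for n
    using continuous_map_compose[OF continuous_map_fst continuous_map_heis_coord]
      continuous_map_compose[OF continuous_map_snd continuous_map_heis_coord] by (simp_all add: o_def)
  have "continuous_map (prod_topology heis_top heis_top) ?D (\<lambda>p. (fst p \<otimes>\<^bsub>heis\<^esub> snd p) n)" for n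
  proof (cases "n mod 3 = 2")
    case True
    have "continuous_map (prod_topology heis_top heis_top) ?D
        (\<lambda>p. ((fst p n + snd p n) mod 2 + (fst p (n - 2) * snd p (n - 1)) mod 2) mod 2)"
      by (rule continuous_map_discrete_binop[where h = "\<lambda>a b. (a + b) mod 2"];
          (rule continuous_map_discrete_binop[where h = "\<lambda>a b. (a + b) mod 2", OF p]
            | rule continuous_map_discrete_binop[where h = "\<lambda>a b. (a * b) mod 2", OF p])?) auto
    then show ?thesis using True by (simp add: heis_mult mod_simps)
  next
    case False
    then show ?thesis
      using continuous_map_discrete_binop[OF p, where h = "\<lambda>a b. (a + b) mod 2" and C = "{..<2}"]
      by (simp add: heis_mult)
  qed
  then have m: "continuous_map (prod_topology heis_top heis_top) heis_top (\<lambda>(f, g). f \<otimes>\<^bsub>heis\<^esub> g)"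
    unfolding heis_top_def continuous_map_componentwise_UNIV by (simp add: case_prod_unfold)
  have "continuous_map heis_top ?D (\<lambda>f. (f n + (if n mod 3 = 2 then f (n - 2) * f (n - 1) else 0)) mod 2)" for n
  proof (cases "n mod 3 = 2")
    case True
    have "continuous_map heis_top ?D (\<lambda>f. (f n + (f (n - 2) * f (n - 1)) mod 2) mod 2)"
      by (rule continuous_map_discrete_binop[where h = "\<lambda>a b. (a + b) mod 2", OF continuous_map_heis_coord
        continuous_map_discrete_binop[where h = "\<lambda>a b. (a * b) mod 2" and C = "{..<2}", OF continuous_map_heis_coord
         continuous_map_heis_coord]]) auto
    then show ?thesis using True by (simp add: mod_simps)
  next
    case False
    then show ?thesis
      using continuous_map_discrete_binop[OF continuous_map_heis_coord continuous_map_heis_coord,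
        where h = "\<lambda>a b. a mod 2" and C = "{..<2}"]
      by simp
  qed
  then have "continuous_map heis_top ?D (\<lambda>f. (inv\<^bsub>heis\<^esub> f) n)" for n
    by (rule continuous_map_eq) (simp add: heis_inv topspace_heis_top)
  then have "continuous_map heis_top heis_top (\<lambda>f. inv\<^bsub>heis\<^esub> f)"
    unfolding heis_top_def continuous_map_componentwise_UNIV by simp
  then show ?thesis
    using m by (simp add: Hausdorff_topological_group_def group_heis topspace_heis_top Hausdorff_heis_top)
qed

section \<open>The compact class-two subgroup of constant sequences\<close>

text \<open>
  Conjugation does not change the \<open>r\<close> part, since \<open>r\<close> is a homomorphism into an abelian group.
\<close>

lemma heis_const_normal: "heis_const \<lhd> heis"
  unfolding heis.normal_inv_iff
proof (intro conjI ballI)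
  show "subgroup heis_const heis"
  proof (rule heis.subgroupI)
    show "heis_const \<subseteq> carrier heis" by (auto dest: heis_constD(1))
    have "(\<lambda>n. 0) \<in> heis_const" by (rule heis_constI) (simp_all add: carrier_heis)
    then show "heis_const \<noteq> {}" by blast
  next
    fix f assume f: "f \<in> heis_const"
    have eq: "(inv\<^bsub>heis\<^esub> f) n = (inv\<^bsub>heis\<^esub> f) 0" if n: "n mod 3 = 0" for n
    proof -
      have "f n = f 0" by (rule heis_constD(2)[OF f n])
      then show ?thesis using n by (simp add: heis_inv[OF heis_constD(1)[OF f]])
    qed
    show "inv\<^bsub>heis\<^esub> f \<in> heis_const"
      by (rule heis_constI[OF heis.inv_closed[OF heis_constD(1)[OF f]] eq])
  next
    fix f g assume f: "f \<in> heis_const" and g: "g \<in> heis_const"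
    have eq: "(f \<otimes>\<^bsub>heis\<^esub> g) n = (f \<otimes>\<^bsub>heis\<^esub> g) 0" if n: "n mod 3 = 0" for n
    proof -
      have "f n = f 0" "g n = g 0" by (rule heis_constD(2)[OF f n], rule heis_constD(2)[OF g n])
      then show ?thesis using n by (simp add: heis_mult)
    qed
    show "f \<otimes>\<^bsub>heis\<^esub> g \<in> heis_const"
      by (rule heis_constI[OF heis.m_closed[OF heis_constD(1)[OF f] heis_constD(1)[OF g]] eq])
  qed
next
  fix x h assume x: "x \<in> carrier heis" and h: "h \<in> heis_const"
  have eq: "(x \<otimes>\<^bsub>heis\<^esub> h \<otimes>\<^bsub>heis\<^esub> inv\<^bsub>heis\<^esub> x) n = h n mod 2" if "n mod 3 = 0" for n
    using that x by (simp add: heis_mult heis_inv mod2_eq_iff) blast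
  show "x \<otimes>\<^bsub>heis\<^esub> h \<otimes>\<^bsub>heis\<^esub> inv\<^bsub>heis\<^esub> x \<in> heis_const"
  proof (rule heis_constI)
    show "x \<otimes>\<^bsub>heis\<^esub> h \<otimes>\<^bsub>heis\<^esub> inv\<^bsub>heis\<^esub> x \<in> carrier heis"
      using x heis_constD(1)[OF h] by simp
  next
    fix n :: nat assume n: "n mod 3 = 0"
    have "0 mod 3 = (0::nat)" by simp
    then show "(x \<otimes>\<^bsub>heis\<^esub> h \<otimes>\<^bsub>heis\<^esub> inv\<^bsub>heis\<^esub> x) n = (x \<otimes>\<^bsub>heis\<^esub> h \<otimes>\<^bsub>heis\<^esub> inv\<^bsub>heis\<^esub> x) 0"
      by (simp only: eq n heis_constD(2)[OF h n])
  qed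
qed

lemma compact_heis_const: "compact_space (subtopology heis_top heis_const)"
proof -
  have "closedin heis_top {f \<in> topspace heis_top. f n = f 0}" for n
    by (rule closedin_continuous_maps_eq[OF _ continuous_map_heis_coord continuous_map_heis_coord])
      (simp add: Hausdorff_space_discrete_topology)
  then have "closedin heis_top (\<Inter>n\<in>{n. n mod 3 = 0}. {f \<in> topspace heis_top. f n = f 0})"
    by (intro closedin_INT) (auto intro: exI[of _ 0])
  moreover have "(\<Inter>n\<in>{n. n mod 3 = 0}. {f \<in> topspace heis_top. f n = f 0}) = heis_const"
    (is "?I = _")
  proof (intro equalityI subsetI)
    fix f assume f: "f \<in> ?I"
    have *: "f \<in> {f \<in> topspace heis_top. f n = f 0}" if "n mod 3 = 0" for n
      by (rule INT_D[OF f]) (use that in simp)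
    show "f \<in> heis_const"
    proof (rule heis_constI)
      show "f \<in> carrier heis" using *[of 0] by (simp add: topspace_heis_top)
      show "f n = f 0" if "n mod 3 = 0" for n using *[OF that] by simp
    qed
  next
    fix f assume f: "f \<in> heis_const"
    show "f \<in> ?I"
    proof (rule INT_I)
      fix n :: nat assume "n \<in> {n. n mod 3 = 0}"
      then have n: "n mod 3 = 0" by simp
      show "f \<in> {f \<in> topspace heis_top. f n = f 0}"
        using heis_constD(1)[OF f] heis_constD(2)[OF f n] by (simp add: topspace_heis_top)
    qed
  qed
  ultimately have "compactin heis_top heis_const"
    using closedin_compact_space[OF compact_heis_top] by simp
  then show ?thesis by (rule compact_space_subtopology)
qed

text \<open>
  In commutators the \<open>r\<close> and \<open>y\<close> parts cancel, leaving triples \<open>(0, 0, z)\<close>, which are central. The elements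
  \<open>(1, 0, 0)\<close> and \<open>(0, e, 0)\<close> with \<open>e\<close> the first unit vector do not commute.
\<close>

lemma nilpotent_heis_const: "nilpotent_of_class (heis\<lparr>carrier := heis_const\<rparr>) 2"
proof -
  let ?G = "heis\<lparr>carrier := heis_const\<rparr>"
  have sub: "subgroup heis_const heis"
    using heis_const_normal by (rule normal_imp_subgroup)
  have gr: "group ?G" by (rule heis.subgroup_imp_group[OF sub])
  have inN: "heis_const \<subseteq> carrier heis" using sub by (rule subgroup.subset)
  have Z: "subgroup heis_centre heis"
  proof (rule heis.subgroupI)
    have "(\<lambda>n. 0) \<in> heis_centre" by (simp add: heis_centre_def carrier_heis)
    then show "heis_centre \<noteq> {}" by blast
  next
    fix f assume "f \<in> heis_centre"
    then show "inv\<^bsub>heis\<^esub> f \<in> heis_centre" by (simp add: heis_centre_def heis_inv)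
  next
    fix f g assume "f \<in> heis_centre" "g \<in> heis_centre"
    then show "f \<otimes>\<^bsub>heis\<^esub> g \<in> heis_centre" by (simp add: heis_centre_def heis_mult)
  qed (auto simp: heis_centre_def)
  have ZN: "heis_centre \<subseteq> heis_const"
    by (auto simp: heis_centre_def intro!: heis_constI)
  have ZG: "subgroup heis_centre ?G" by (rule heis.subgroup_incl[OF Z sub ZN])
  let ?a = "\<lambda>n::nat. if n mod 3 = 0 then 1 else 0 :: nat" and ?b = "\<lambda>n::nat. if n = 1 then 1 else 0 :: nat"
  show ?thesis
  proof (rule nilpotent_of_class_2I[OF gr ZG, of ?a ?b])
    fix x y assume "x \<in> carrier ?G" "y \<in> carrier ?G"
    then have N: "x \<in> heis_const" "y \<in> heis_const" and xy: "x \<in> carrier heis" "y \<in> carrier heis"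
      using inN by auto
    have "(x \<otimes>\<^bsub>heis\<^esub> y \<otimes>\<^bsub>heis\<^esub> inv\<^bsub>heis\<^esub> x \<otimes>\<^bsub>heis\<^esub> inv\<^bsub>heis\<^esub> y) n = 0" if "n mod 3 \<noteq> 2" for n
    proof -
      show ?thesis using that xy by (auto simp: heis_mult heis_inv mod2_eq_iff)
    qed
    then show "x \<otimes>\<^bsub>?G\<^esub> y \<otimes>\<^bsub>?G\<^esub> inv\<^bsub>?G\<^esub> x \<otimes>\<^bsub>?G\<^esub> inv\<^bsub>?G\<^esub> y \<in> heis_centre"
      using N xy by (simp add: heis.m_inv_consistent[OF sub] heis_centre_def)
  next
    fix z y assume zy: "z \<in> heis_centre" "y \<in> carrier ?G"
    have "(z \<otimes>\<^bsub>heis\<^esub> y) n = (y \<otimes>\<^bsub>heis\<^esub> z) n" for n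
      using zy(1) mod3_pred[of n] by (cases "n mod 3 = 2") (simp_all add: heis_centre_def heis_mult add.commute)
    then show "z \<otimes>\<^bsub>?G\<^esub> y = y \<otimes>\<^bsub>?G\<^esub> z" by auto
  next
    show "?a \<in> carrier ?G" "?b \<in> carrier ?G"
      by (auto simp: carrier_heis intro!: heis_constI)
    have "(?a \<otimes>\<^bsub>heis\<^esub> ?b) 2 \<noteq> (?b \<otimes>\<^bsub>heis\<^esub> ?a) 2"
      by (simp add: heis_mult)
    then show "?a \<otimes>\<^bsub>?G\<^esub> ?b \<noteq> ?b \<otimes>\<^bsub>?G\<^esub> ?a" by auto
  qed
qed

section \<open>The finitely supported sequences and their action\<close>

lemma heis_finD:
  assumes "s \<in> heis_fin"
  shows "s \<in> carrier heis" "n mod 3 \<noteq> 0 \<Longrightarrow> s n = 0" "finite {n. s n \<noteq> 0}"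
  using assms by (simp_all add: heis_fin_def)

lemma heis_mult_fin:
  assumes "s \<in> heis_fin"
  shows "(f \<otimes>\<^bsub>heis\<^esub> s) n = (f n + s n) mod 2"
proof (cases "n mod 3 = 2")
  case True
  have "s (n - 1) = 0"
    by (rule heis_finD(2)[OF assms]) (simp add: mod3_pred[OF True])
  then show ?thesis by (simp add: heis_mult)
qed (simp add: heis_mult)

lemma heis_inv_fin:
  assumes "s \<in> heis_fin"
  shows "inv\<^bsub>heis\<^esub> s = s"
proof (rule heis.inv_equality)
  show "s \<otimes>\<^bsub>heis\<^esub> s = \<one>\<^bsub>heis\<^esub>"
    by (simp add: fun_eq_iff heis_mult_fin[OF assms] heis_one)
qed (rule heis_finD(1)[OF assms])+

lemma subgroup_heis_fin: "subgroup heis_fin heis"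
proof (rule heis.subgroupI)
  show "heis_fin \<subseteq> carrier heis" by (auto dest: heis_finD(1))
  have "(\<lambda>n. 0) \<in> heis_fin" by (simp add: heis_fin_def carrier_heis)
  then show "heis_fin \<noteq> {}" by blast
next
  fix f assume "f \<in> heis_fin"
  then show "inv\<^bsub>heis\<^esub> f \<in> heis_fin" by (simp add: heis_inv_fin)
next
  fix f g assume fg: "f \<in> heis_fin" "g \<in> heis_fin"
  have eq: "(f \<otimes>\<^bsub>heis\<^esub> g) n = (f n + g n) mod 2" for n
    by (rule heis_mult_fin[OF fg(2)])
  have "{n. (f \<otimes>\<^bsub>heis\<^esub> g) n \<noteq> 0} \<subseteq> {n. f n \<noteq> 0} \<union> {n. g n \<noteq> 0}"
    by (auto simp: eq)
  then have "finite {n. (f \<otimes>\<^bsub>heis\<^esub> g) n \<noteq> 0}"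
    by (rule finite_subset) (intro finite_UnI heis_finD(3) fg)
  then show "f \<otimes>\<^bsub>heis\<^esub> g \<in> heis_fin"
    using heis_finD(2)[OF fg(1)] heis_finD(2)[OF fg(2)] by (simp add: heis_fin_def carrier_heis eq)
qed

text \<open>
  Conjugation by \<open>(s, 0, 0)\<close> sends \<open>(0, e, 0)\<close> to \<open>(0, e, s e)\<close>; taking for \<open>e\<close> the unit vector at
  position \<open>k = n / 3\<close>, the \<open>z\<close> part at \<open>k\<close> is the \<open>k\<close>-th term of \<open>s\<close>.
\<close>

definition recover_conjugator :: "((nat \<Rightarrow> nat) \<Rightarrow> nat \<Rightarrow> nat) \<Rightarrow> nat \<Rightarrow> nat" where
  "recover_conjugator p = (\<lambda>n. if n mod 3 = 0 then p (\<lambda>k. if k = n + 1 then 1 else 0) (n + 2) else 0)"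

lemma unit_y_in_heis_const:
  assumes n: "n mod 3 = 0"
  shows "(\<lambda>k. if k = n + 1 then 1 else 0) \<in> heis_const"
proof (rule heis_constI)
  fix k :: nat assume "k mod 3 = 0"
  then have "k \<noteq> n + 1" using mod3_succ(1)[OF n] by (intro notI) simp
  then show "(if k = n + 1 then 1 else 0) = (if 0 = n + 1 then 1 else 0 :: nat)" by simp
qed (simp add: carrier_heis)

lemma recover_conjugator_conjugation:
  assumes s: "s \<in> heis_fin"
  shows "recover_conjugator (conjugation heis heis_const s) = s"
proof
  fix n
  show "recover_conjugator (conjugation heis heis_const s) n = s n"
  proof (cases "n mod 3 = 0")
    case True
    let ?d = "\<lambda>k. if k = n + 1 then 1 else 0 :: nat"
    note m = mod3_succ(2)[OF True]
    have lt: "s n < 2" using heis_finD(1)[OF s] by (simp add: carrier_heis)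
    have s2: "s (n + 2) = 0" by (rule heis_finD(2)[OF s]) (simp only: m)
    have "recover_conjugator (conjugation heis heis_const s) n = (s \<otimes>\<^bsub>heis\<^esub> ?d \<otimes>\<^bsub>heis\<^esub> s) (n + 2)"
      using True unit_y_in_heis_const[OF True] by (simp add: recover_conjugator_def conjugation_def heis_inv_fin[OF s])
    also have "\<dots> = ((s \<otimes>\<^bsub>heis\<^esub> ?d) (n + 2) + s (n + 2)) mod 2"
      by (rule heis_mult_fin[OF s])
    also have "\<dots> = s n"
      using lt unfolding heis_mult m s2 by simp
    finally show ?thesis .
  next
    case False
    then show ?thesis by (simp add: recover_conjugator_def heis_finD(2)[OF s])
  qed
qed

lemma continuous_map_recover_conjugator:
  "continuous_map
     (subtopology (compact_open_topology (heis\<lparr>carrier := heis_const\<rparr>) (subtopology heis_top heis_const)) P)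
     heis_top recover_conjugator"
  (is "continuous_map ?X _ _")
proof -
  have ts: "topspace (subtopology heis_top heis_const) = carrier (heis\<lparr>carrier := heis_const\<rparr>)"
    by (auto simp: topspace_heis_top dest: heis_constD(1))
  have "continuous_map ?X (discrete_topology {..<2}) (\<lambda>p. recover_conjugator p n)" for n
  proof (cases "n mod 3 = 0")
    case True
    have "continuous_map ?X (subtopology heis_top heis_const) (\<lambda>p. p (\<lambda>k. if k = n + 1 then 1 else 0))"
      by (rule continuous_map_from_subtopology[OF continuous_map_eval_compact_open[OF ts]])
        (use unit_y_in_heis_const[OF True] in simp)
    from continuous_map_compose[OF this continuous_map_from_subtopology[OF continuous_map_heis_coord[of "n + 2"]]]
    show ?thesis using True by (simp add: recover_conjugator_def o_def)
  qed (simp add: recover_conjugator_def)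
  then show ?thesis
    unfolding heis_top_def continuous_map_componentwise_UNIV by simp
qed

text \<open>
  The witnesses are \<open>(1, 0, 0)\<close> and \<open>(s, 0, 0)\<close> with \<open>s\<close> a long initial segment of ones: the \<open>r\<close> part of
  their product is supported beyond that segment.
\<close>

lemma heis_const_times_heis_fin_near_one:
  assumes "openin heis_top V" "\<one>\<^bsub>heis\<^esub> \<in> V"
  shows "\<exists>x\<in>heis_const - {f \<in> heis_const. f 0 = 0}. \<exists>s\<in>heis_fin. x \<otimes>\<^bsub>heis\<^esub> s \<in> V"
proof -
  let ?a = "\<lambda>n::nat. if n mod 3 = 0 then 1 else 0 :: nat"
  let ?s = "\<lambda>k n::nat. if n mod 3 = 0 \<and> n < k then 1 else 0 :: nat"
  have prod: "(?a \<otimes>\<^bsub>heis\<^esub> ?s k) n = (if n mod 3 = 0 \<and> k \<le> n then 1 else 0)" for k n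
    by (cases "n mod 3 = 2") (auto simp: heis_mult mod3_pred)
  have "limitin heis_top (\<lambda>k. ?a \<otimes>\<^bsub>heis\<^esub> ?s k) \<one>\<^bsub>heis\<^esub> sequentially"
    unfolding heis_top_def limitin_componentwise
  proof (intro conjI ballI)
    show "\<forall>\<^sub>F k in sequentially. ?a \<otimes>\<^bsub>heis\<^esub> ?s k \<in> topspace (product_topology (\<lambda>n. discrete_topology {..<2}) UNIV)"
      by (rule always_eventually) (auto simp: heis_mult)
    fix n
    have "\<forall>\<^sub>F k in sequentially. (?a \<otimes>\<^bsub>heis\<^esub> ?s k) n = 0"
      unfolding prod eventually_sequentially by (rule exI[of _ "Suc n"]) auto
    then show "limitin (discrete_topology {..<2}) (\<lambda>k. (?a \<otimes>\<^bsub>heis\<^esub> ?s k) n) (\<one>\<^bsub>heis\<^esub> n) sequentially"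
      unfolding limitin_def by (auto simp: heis_one elim!: eventually_mono)
  qed simp
  then have "\<forall>\<^sub>F k in sequentially. ?a \<otimes>\<^bsub>heis\<^esub> ?s k \<in> V"
    using assms by (simp add: limitin_def)
  then obtain k where "?a \<otimes>\<^bsub>heis\<^esub> ?s k \<in> V"
    by (meson eventually_sequentially order_refl)
  moreover have "?a \<in> heis_const - {f \<in> heis_const. f 0 = 0}"
    by (simp add: heis_constI carrier_heis)
  moreover have "?s k \<in> heis_fin"
    by (simp add: heis_fin_def carrier_heis)
  ultimately show ?thesis by blast
qed

section \<open>The compact group with a non-minimal semidirect product\<close>

theorem mainTheorem5:
  shows "\<exists>(G :: (nat \<Rightarrow> nat) monoid) (T :: (nat \<Rightarrow> nat) topology) (P :: ((nat \<Rightarrow> nat) \<Rightarrow> (nat \<Rightarrow> nat)) set).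
           Hausdorff_topological_group G T \<and> compact_space T \<and> nilpotent_of_class G 2 \<and>
           subgroup P (top_AutoGroup G T) \<and>
           \<not> minimal_topological_group (semidirect_product G P) (semidirect_topology G T P)"
proof -
  let ?G = "heis\<lparr>carrier := heis_const\<rparr>" and ?T = "subtopology heis_top heis_const"
    and ?P = "conjugation heis heis_const ` heis_fin"
  have one: "\<one>\<^bsub>heis\<^esub> \<in> heis_const"
    using heis_const_normal by (rule normal_imp_subgroup[THEN subgroup.one_closed])
  have int: "heis_const \<inter> heis_fin = {\<one>\<^bsub>heis\<^esub>}"
  proof (intro equalityI subsetI)
    fix f assume "f \<in> heis_const \<inter> heis_fin"
    then have c: "\<And>n. n mod 3 = 0 \<Longrightarrow> f n = f 0" and z: "\<And>n. n mod 3 \<noteq> 0 \<Longrightarrow> f n = 0"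
      and fin: "finite {n. f n \<noteq> 0}"
      using heis_constD(2) by (auto simp: heis_fin_def)
    have "f 0 = 0"
    proof (rule ccontr)
      assume "f 0 \<noteq> 0"
      moreover have "f (3 * n) = f 0" for n by (rule c) simp
      ultimately have "range (\<lambda>n. 3 * n) \<subseteq> {n. f n \<noteq> 0}" by (intro image_subsetI CollectI) simp
      then have "finite (range (\<lambda>n::nat. 3 * n))" using fin by (rule finite_subset)
      then show False using finite_imageD[of "\<lambda>n::nat. 3 * n" UNIV] by (simp add: inj_on_def)
    qed
    then have "f n = 0" for n using c[of n] z[of n] by (cases "n mod 3 = 0") simp_all
    then show "f \<in> {\<one>\<^bsub>heis\<^esub>}" by (auto simp: heis_one)
  qed (use one subgroup.one_closed[OF subgroup_heis_fin] in auto)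
  have "openin ?T {f \<in> topspace ?T. f 0 \<in> {0}}"
    by (rule openin_continuous_map_preimage[OF continuous_map_from_subtopology[OF continuous_map_heis_coord]]) simp
  moreover have "topspace ?T = heis_const"
    by (auto simp: topspace_heis_top dest: heis_constD(1))
  ultimately have U: "openin ?T {f \<in> heis_const. f 0 = 0}" by (simp only: singleton_iff)
  have U1: "\<one>\<^bsub>heis\<^esub> \<in> {f \<in> heis_const. f 0 = 0}"
    using one by (simp add: heis_one)
  have "Hausdorff_topological_group ?G ?T"
    using Hausdorff_topological_group_subgroup[OF Hausdorff_topological_group_heis
        normal_imp_subgroup[OF heis_const_normal]] .
  moreover note compact_heis_const nilpotent_heis_const
    semidirect_product_not_minimal[OF Hausdorff_topological_group_heis heis_const_normal
      subgroup_heis_fin int recover_conjugator_conjugation continuous_map_recover_conjugator U U1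
      heis_const_times_heis_fin_near_one]
  ultimately show ?thesis by blast
qed

end
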